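(* For every positive integer $n$ let $C_k=\frac{1}{k+1}\binom{2k}{k}$ denote the $k$-th Catalan number and $S_n=\sum_{k=1}^{n} C_k$. Let $u(n)=\dfrac{4^{n+1}}{3\sqrt{\pi n^3}}$ and $\vartheta(n)=\dfrac{4^{n+1}}{3(n+1)\sqrt{\pi n}}$. Then for all integers $n\ge 8$, $$u(n)+\vartheta(n) > 2S_n.$$
   Context: The sum $S_n$ starts at $k=1$ (it does not include $C_0$). *)

theory Defs
  imports Complex_Main
begin

definition catalan :: "nat \<Rightarrow> real" where
  "catalan k = 1 / (real k + 1) * real ((2 * k) choose k)"

definition catalan_sum :: "nat \<Rightarrow> real" where
  "catalan_sum n = (\<Sum>k = 1..n. catalan k)"

definition u :: "nat \<Rightarrow> real" where
  "u n = 4 ^ (n + 1) / (3 * sqrt (pi * real n ^ 3))"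

definition vartheta :: "nat \<Rightarrow> real" where
  "vartheta n = 4 ^ (n + 1) / (3 * (real n + 1) * sqrt (pi * real n))"

end

theory Submission
  imports Defs "HOL-Analysis.Gamma_Function" "HOL-Real_Asymp.Real_Asymp"
begin

text \<open>
  By Wallis' product, \<open>16 ^ n / (binom(2n, n)\<^sup>2 * (n + 1/4))\<close> decreases to \<open>\<pi>\<close>, so
  \<open>binom(2n, n) \<le> 4 ^ n / sqrt (\<pi> * (n + 1/4))\<close>. The shift by \<open>1/4\<close> makes this bound sharp
  enough for the inequality to propagate from \<open>m - 1\<close> to \<open>m\<close> for every \<open>m \<ge> 9\<close>: after replacing
  the quotients of square roots by their AM-GM bounds, the step is a rational inequality in \<open>m\<close>.
  The base case \<open>n = 8\<close> is numerical.
\<close>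

lemma central_binomial_Suc:
  "(real n + 1) * real ((2 * Suc n) choose Suc n) = 2 * (2 * real n + 1) * real ((2 * n) choose n)"
proof -
  have "Suc n * ((2 * Suc n) choose Suc n) = Suc (2 * n + 1) * ((2 * n + 1) choose n)"
    using Suc_times_binomial[of n "2 * n + 1"] by simp
  \<comment> \<open>Symmetry moves the lower index to \<open>Suc n\<close>, so that the absorption
    identity applies a second time.\<close>
  also have "(2 * n + 1) choose n = (2 * n + 1) choose Suc n"
    by (subst binomial_symmetric) auto
  finally have "Suc n * ((2 * Suc n) choose Suc n) = 2 * (Suc n * (Suc (2 * n) choose Suc n))"
    by simp
  also have "Suc n * (Suc (2 * n) choose Suc n) = Suc (2 * n) * ((2 * n) choose n)"
    by (rule Suc_times_binomial)
  finally have "real (Suc n * ((2 * Suc n) choose Suc n)) =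
      real (2 * (Suc (2 * n) * ((2 * n) choose n)))"
    by (rule arg_cong)
  then show ?thesis
    unfolding of_nat_mult by (simp add: algebra_simps del: binomial_Suc_Suc mult_Suc_right)
qed

text \<open>Passing from \<open>n\<close> to \<open>Suc n\<close> multiplies the left side by
  exactly 16: the new Wallis factor has denominator (2n+1)(2n+3), which cancels against the ratios
  of the binomials and of the linear factors. This turns the limit of Wallis' product into
  information on central binomials.\<close>

lemma wallis_prod_central_binomial:
  "real ((2 * n) choose n) ^ 2 * (2 * real n + 1) *
     (\<Prod>k = 1..n. (4 * real k ^ 2) / (4 * real k ^ 2 - 1)) = 16 ^ n"
proof (induction n)
  case 0
  show ?case by simp
next
  case (Suc n)
  define b where "b = real ((2 * n) choose n)"
  define P where "P = (\<Prod>k = 1..n. (4 * real k ^ 2) / (4 * real k ^ 2 - 1))"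
  have b': "real ((2 * Suc n) choose Suc n) = 2 * (2 * real n + 1) * b / (real n + 1)"
    using central_binomial_Suc[of n] unfolding b_def by (simp add: field_simps)
  have "(\<Prod>k = 1..Suc n. (4 * real k ^ 2) / (4 * real k ^ 2 - 1)) =
      P * (4 * (real n + 1) ^ 2 / (4 * (real n + 1) ^ 2 - 1))"
    unfolding P_def by (simp add: add.commute)
  also have "4 * (real n + 1) ^ 2 - 1 = (2 * real n + 1) * (2 * real n + 3)"
    by (simp add: power2_eq_square algebra_simps)
  finally have P': "(\<Prod>k = 1..Suc n. (4 * real k ^ 2) / (4 * real k ^ 2 - 1)) =
      P * (4 * (real n + 1) ^ 2 / ((2 * real n + 1) * (2 * real n + 3)))" .
  have "(2 * (2 * real n + 1) * b / (real n + 1)) ^ 2 * (2 * real (Suc n) + 1) *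
      (P * (4 * (real n + 1) ^ 2 / ((2 * real n + 1) * (2 * real n + 3)))) =
      16 * (b ^ 2 * (2 * real n + 1) * P)"
  proof -
    have "(2 * (2 * x + 1) * b / (x + 1)) ^ 2 * (2 * x + 3) *
      (P * (4 * (x + 1) ^ 2 / ((2 * x + 1) * (2 * x + 3)))) =
      16 * (b ^ 2 * (2 * x + 1) * P)" if "x \<ge> 0" for x :: real
    proof -
      have "x + 1 \<noteq> 0" "2 * x + 1 \<noteq> 0" "2 * x + 3 \<noteq> 0" using that by auto
      then show ?thesis by (simp add: divide_simps power2_eq_square; algebra)
    qed
    from this[of "real n"] show ?thesis by (simp add: algebra_simps)
  qed
  also have "\<dots> = 16 ^ Suc n"
    using Suc.IH unfolding b_def P_def by simp
  finally show ?case
    unfolding b' P' .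
qed

lemma central_binomial_square_upper_bound:
  "pi * (real n + 1 / 4) * real ((2 * n) choose n) ^ 2 \<le> 16 ^ n"
proof -
  define P where "P n = (\<Prod>k = 1..n. (4 * real k ^ 2) / (4 * real k ^ 2 - 1))" for n
  \<comment> \<open>The extra factor replaces \<open>2 * real n + 1\<close> by
    \<open>real n + 1 / 4\<close> and tends to 2, which doubles the Wallis limit
    \<open>pi / 2\<close>.\<close>
  define Q where "Q n = P n * ((2 * real n + 1) / (real n + 1 / 4))" for n
  have P_pos: "P n > 0" for n
  proof -
    have "4 * real k ^ 2 - 1 > 0" if "k \<ge> 1" for k
      using one_le_power[of "real k" 2] that by linarith
    then show ?thesis
      unfolding P_def by (intro prod_pos) (auto intro!: divide_pos_pos)
  qed
  have "(\<lambda>n. (2 * real n + 1) / (real n + 1 / 4)) \<longlonglongrightarrow> 2"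
    by real_asymp
  then have "Q \<longlonglongrightarrow> pi / 2 * 2"
    unfolding Q_def P_def by (intro tendsto_mult wallis)
  moreover have "decseq Q"
  proof (rule decseq_SucI)
    fix n
    define x where "x = real n"
    have x: "x \<ge> 0" by (simp add: x_def)
    have "4 * (x + 1) ^ 2 / (4 * (x + 1) ^ 2 - 1) * ((2 * x + 3) / (x + 5 / 4)) \<le>
        (2 * x + 1) / (x + 1 / 4)"
    proof -
      have "4 * (x + 1) ^ 2 / (4 * (x + 1) ^ 2 - 1) * ((2 * x + 3) / (x + 5 / 4)) =
          4 * (x + 1) ^ 2 / ((2 * x + 1) * (x + 5 / 4))"
      proof -
        have "4 * (x + 1) ^ 2 - 1 = (2 * x + 1) * (2 * x + 3)"
          by (simp add: power2_eq_square algebra_simps)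
        then show ?thesis using x by simp
      qed
      also have "\<dots> \<le> (2 * x + 1) / (x + 1 / 4)"
      proof -
        \<comment> \<open>Monotonicity after cross-multiplication. With the shift 1/4 the linear
          terms agree too, and the two sides differ by a constant only.\<close>
        have "4 * (x + 1) ^ 2 * (x + 1 / 4) + 1 / 4 = (2 * x + 1) * ((2 * x + 1) * (x + 5 / 4))"
          by (simp add: power2_eq_square algebra_simps)
        moreover have "(2 * x + 1) * (x + 5 / 4) > 0" "x + 1 / 4 > 0"
          using x by (auto intro!: mult_pos_pos)
        ultimately show ?thesis by (simp only: divide_le_eq pos_le_divide_eq) (simp add: field_simps)
      qed
      finally show ?thesis .
    qed
    moreover have "P (Suc n) = P n * (4 * (x + 1) ^ 2 / (4 * (x + 1) ^ 2 - 1))"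
      unfolding P_def x_def by (simp add: add.commute)
    then have "Q (Suc n) =
        P n * (4 * (x + 1) ^ 2 / (4 * (x + 1) ^ 2 - 1) * ((2 * x + 3) / (x + 5 / 4)))"
      unfolding Q_def by (simp add: x_def algebra_simps)
    moreover have "Q n = P n * ((2 * x + 1) / (x + 1 / 4))"
      unfolding Q_def x_def ..
    ultimately show "Q (Suc n) \<le> Q n"
      using P_pos[of n] by (simp only: mult_left_mono less_imp_le)
  qed
  ultimately have "pi \<le> Q n"
    using decseq_ge[of Q pi n] by simp
  then have "pi * (real n + 1 / 4) \<le> P n * (2 * real n + 1)"
    unfolding Q_def by (simp add: field_simps)
  then have "pi * (real n + 1 / 4) * real ((2 * n) choose n) ^ 2 \<le>
      P n * (2 * real n + 1) * real ((2 * n) choose n) ^ 2"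
    by (intro mult_right_mono) auto
  also have "\<dots> = 16 ^ n"
    using wallis_prod_central_binomial[of n] unfolding P_def by (simp only: mult_ac)
  finally show ?thesis .
qed

text \<open>By AM-GM, sqrt(n(n + 1/4)) \<le> n + 1/8; dividing by n + 1/4 bounds sqrt(n / (n + 1/4))
  by the rational factor shown. The root left over is the one in \<open>u\<close> and
  \<open>vartheta\<close>.\<close>

lemma central_binomial_upper_bound:
  assumes "n > 0"
  shows "real ((2 * n) choose n) \<le> 4 ^ n / sqrt (pi * real n) * ((8 * real n + 1) / (8 * real n + 2))"
proof (rule power2_le_imp_le)
  let ?x = "real n"
  have x: "?x > 0" using assms by simp
  have "real ((2 * n) choose n) ^ 2 \<le> 16 ^ n / (pi * (?x + 1 / 4))"
    using central_binomial_square_upper_bound[of n] x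
    by (subst pos_le_divide_eq) (auto simp: mult_ac intro!: mult_pos_pos add_pos_pos)
  also have "\<dots> \<le> 16 ^ n / (pi * ?x) * ((8 * ?x + 1) / (8 * ?x + 2)) ^ 2"
  proof -
    have "1 / (?x + 1 / 4) \<le> 1 / ?x * ((8 * ?x + 1) / (8 * ?x + 2)) ^ 2"
    proof -
      have "?x * (8 * ?x + 2) ^ 2 \<le> (8 * ?x + 1) ^ 2 * (?x + 1 / 4)"
        using x by (simp add: power2_eq_square algebra_simps)
      then show ?thesis using x by (simp add: power_divide divide_le_eq pos_le_divide_eq mult_ac)
    qed
    then have "16 ^ n / pi * (1 / (?x + 1 / 4)) \<le>
        16 ^ n / pi * (1 / ?x * ((8 * ?x + 1) / (8 * ?x + 2)) ^ 2)"
      by (intro mult_left_mono) auto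
    then show ?thesis by simp
  qed
  also have "\<dots> = (4 ^ n / sqrt (pi * ?x) * ((8 * ?x + 1) / (8 * ?x + 2))) ^ 2"
  proof -
    have "(4 ^ n :: real) ^ 2 = 16 ^ n"
      by (simp add: power2_eq_square flip: power_mult_distrib)
    moreover have "sqrt (pi * ?x) ^ 2 = pi * ?x" by simp
    ultimately show ?thesis by (simp only: power_mult_distrib power_divide)
  qed
  finally show "real ((2 * n) choose n) ^ 2 \<le>
    (4 ^ n / sqrt (pi * ?x) * ((8 * ?x + 1) / (8 * ?x + 2))) ^ 2" .
qed simp

text \<open>Both summands carry the same root, so their sum is a rational multiple of
  \<open>4 ^ (n + 1) / sqrt (pi * real n)\<close>.\<close>

lemma u_plus_vartheta:
  assumes "n > 0"
  shows "u n + vartheta n =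
    4 ^ (n + 1) * (2 * real n + 1) / (3 * real n * (real n + 1)) / sqrt (pi * real n)"
proof -
  have "sqrt (pi * real n ^ 3) = real n * sqrt (pi * real n)"
    by (simp add: real_sqrt_mult power3_eq_cube)
  then have "u n = 4 ^ (n + 1) / (3 * real n) / sqrt (pi * real n)"
    by (simp add: u_def)
  moreover have "vartheta n = 4 ^ (n + 1) / (3 * (real n + 1)) / sqrt (pi * real n)"
    by (simp add: vartheta_def)
  moreover have "4 ^ (n + 1) / (3 * real n) + 4 ^ (n + 1) / (3 * (real n + 1)) =
      4 ^ (n + 1) * (2 * real n + 1) / (3 * real n * (real n + 1))"
    using assms by (simp add: divide_simps) (simp add: algebra_simps)
  ultimately show ?thesis by (simp only: flip: add_divide_distrib)
qed

text \<open>AM-GM in the form sqrt(x(x - 1)) \<le> x - 1/2, divided by x - 1. It expresses the bound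
  at the previous index through the root at the current one.\<close>

lemma inverse_sqrt_pred_le:
  fixes x :: real
  assumes "x > 1"
  shows "1 / sqrt (pi * (x - 1)) \<le> 1 / sqrt (pi * x) * ((2 * x - 1) / (2 * (x - 1)))"
proof (rule power2_le_imp_le)
  have "1 / (x - 1) \<le> 1 / x * ((2 * x - 1) / (2 * (x - 1))) ^ 2"
  proof -
    have "x * (2 * (x - 1)) ^ 2 \<le> (2 * x - 1) ^ 2 * (x - 1)"
      using assms by (simp add: power2_eq_square algebra_simps)
    then show ?thesis using assms by (simp add: power_divide divide_le_eq pos_le_divide_eq mult_ac)
  qed
  then have "1 / pi * (1 / (x - 1)) \<le> 1 / pi * (1 / x * ((2 * x - 1) / (2 * (x - 1))) ^ 2)"
    by (intro mult_left_mono) auto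
  moreover have "sqrt (pi * x) ^ 2 = pi * x" "sqrt (pi * (x - 1)) ^ 2 = pi * (x - 1)"
    using assms by auto
  ultimately show "(1 / sqrt (pi * (x - 1))) ^ 2 \<le>
      (1 / sqrt (pi * x) * ((2 * x - 1) / (2 * (x - 1)))) ^ 2"
    by (simp only: power_mult_distrib power_divide) simp
qed (use assms in simp)

text \<open>The induction step with the common factor \<open>4 ^ Suc n / sqrt (pi * x)\<close>
  removed, where x = n + 1: the old bound plus twice the new Catalan number against the new
  bound.\<close>

lemma rational_step_inequality:
  fixes x :: real
  assumes "x \<ge> 9"
  shows "(2 * x - 1) / (3 * (x - 1) * x) * ((2 * x - 1) / (2 * (x - 1))) +
      2 / (x + 1) * ((8 * x + 1) / (8 * x + 2)) \<le> 4 * (2 * x + 1) / (3 * x * (x + 1))"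
proof -
  define y where "y = x - 9"
  have y: "y \<ge> 0" and x: "x = y + 9" using assms by (auto simp: y_def)
  let ?N = "8 * (2 * x + 1) * (x - 1) ^ 2 * (4 * x + 1) - (2 * x - 1) ^ 2 * (x + 1) * (4 * x + 1)
      - 6 * x * (x - 1) ^ 2 * (8 * x + 1)"
  let ?D = "6 * x * (x + 1) * (x - 1) ^ 2 * (4 * x + 1)"
  \<comment> \<open>The quartic terms cancel, leaving 6x^3 - 48x^2 + 25x + 7. In \<open>y\<close>
    this is 6y^3 + 114y^2 + 619y + 718, with positive coefficients only.\<close>
  have "?N \<ge> 0"
    using y unfolding x by (simp add: power2_eq_square algebra_simps)
  moreover have "?D > 0" using assms by (intro mult_pos_pos zero_less_power) auto
  ultimately have "?N / ?D \<ge> 0" by simp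
  also have "?N / ?D = 4 * (2 * x + 1) / (3 * x * (x + 1))
      - (2 * x - 1) / (3 * (x - 1) * x) * ((2 * x - 1) / (2 * (x - 1)))
      - 2 / (x + 1) * ((8 * x + 1) / (8 * x + 2))"
  proof -
    have nz: "x \<noteq> 0" "x + 1 \<noteq> 0" "x - 1 \<noteq> 0" "4 * x + 1 \<noteq> 0" using assms by auto
    have "8 * x + 2 = 2 * (4 * x + 1)" by simp
    then show ?thesis
      using nz by (simp only:) (simp add: divide_simps power2_eq_square; algebra)
  qed
  finally show ?thesis by simp
qed

text \<open>All three quantities are measured in units of \<open>T\<close>, which reduces the claim
  to the rational inequality.\<close>

lemma catalan_le_increment:
  assumes "n \<ge> 8"
  shows "2 * catalan (Suc n) \<le> (u (Suc n) + vartheta (Suc n)) - (u n + vartheta n)"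
proof -
  define x where "x = real (Suc n)"
  define T where "T = 4 ^ Suc n / sqrt (pi * x)"
  have x: "x \<ge> 9" and n: "real n = x - 1" using assms by (auto simp: x_def)
  have T: "T \<ge> 0" using x by (simp add: T_def)
  have "2 * catalan (Suc n) = 2 / (x + 1) * real ((2 * Suc n) choose Suc n)"
    unfolding catalan_def x_def by simp
  also have "\<dots> \<le> 2 / (x + 1) * (T * ((8 * x + 1) / (8 * x + 2)))"
    using central_binomial_upper_bound[of "Suc n"] x unfolding T_def x_def
    by (intro mult_left_mono) auto
  finally have C: "2 * catalan (Suc n) \<le> T * (2 / (x + 1) * ((8 * x + 1) / (8 * x + 2)))"
    by (simp add: mult_ac)
  have "u n + vartheta n =
      4 ^ Suc n * (2 * x - 1) / (3 * (x - 1) * x) * (1 / sqrt (pi * (x - 1)))"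
  proof -
    have "2 * (x - 1) + 1 = 2 * x - 1" "x - 1 + 1 = x" by simp_all
    then show ?thesis
      using u_plus_vartheta[of n] assms unfolding n by simp
  qed
  also have "\<dots> \<le> 4 ^ Suc n * (2 * x - 1) / (3 * (x - 1) * x) *
      (1 / sqrt (pi * x) * ((2 * x - 1) / (2 * (x - 1))))"
    using x by (intro mult_left_mono inverse_sqrt_pred_le) auto
  also have "\<dots> = T * ((2 * x - 1) / (3 * (x - 1) * x) * ((2 * x - 1) / (2 * (x - 1))))"
    unfolding T_def by (simp add: mult_ac)
  finally have "u n + vartheta n + 2 * catalan (Suc n) \<le>
      T * ((2 * x - 1) / (3 * (x - 1) * x) * ((2 * x - 1) / (2 * (x - 1))) +
      2 / (x + 1) * ((8 * x + 1) / (8 * x + 2)))"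
    using C unfolding distrib_left by linarith
  also have "\<dots> \<le> T * (4 * (2 * x + 1) / (3 * x * (x + 1)))"
    by (intro mult_left_mono rational_step_inequality x T)
  also have "\<dots> = u (Suc n) + vartheta (Suc n)"
    using u_plus_vartheta[of "Suc n"] unfolding x_def[symmetric] T_def by (simp add: mult_ac)
  finally show ?thesis by simp
qed

lemma catalan_sum_8: "catalan_sum 8 = 2055"
  by (simp add: catalan_sum_def catalan_def numeral_eq_Suc)

theorem theorem2:
  fixes n :: nat
  assumes "n \<ge> 8"
  shows "u n + vartheta n > 2 * catalan_sum n"
  using assms
proof (induction n rule: nat_induct_at_least)
  case base
  \<comment> \<open>The root is about 5.0133, while the claim needs it below 4^9 * 17 / (216 *
    4110), about 5.0199. Here 4110 is twice \<open>catalan_sum 8\<close>, and 17 and 216 are 2n+1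
    and 3n(n+1) at n = 8.\<close>
  have "sqrt (pi * 8) < 5.016"
    using pi_approx by (intro real_less_lsqrt) (auto simp: power2_eq_square)
  moreover have "sqrt (pi * 8) > 0" by simp
  ultimately have "4110 * sqrt (pi * 8) < 4 ^ 9 * 17 / 216"
    by simp
  then have "4110 < 4 ^ 9 * 17 / 216 / sqrt (pi * 8)"
    by (simp add: pos_less_divide_eq)
  then show ?case
    using u_plus_vartheta[of 8] by (simp add: catalan_sum_8)
next
  case (Suc n)
  have "catalan_sum (Suc n) = catalan_sum n + catalan (Suc n)"
    by (simp add: catalan_sum_def)
  then show ?case
    using Suc.IH catalan_le_increment[OF Suc.hyps] by simp
qed

end
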